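(* Assume that the operator $\mathcal F:\mathcal M\subseteq X\to L_2(\Omega)$, $\mathcal F(\mathbf a)=\mathcal I_2\circ G(\mathbf a)$, is continuous and weakly sequentially closed, that for the given noise-free image $\mathcal I_1$ there exists an $\mathbf a_0$-minimum-norm-solution of $\mathcal I_2\circ G(\mathbf a)=\mathcal I_1$, and that the noisy image $\mathcal I_1^\delta$ satisfies $\|\mathcal I_1-\mathcal I_1^\delta\|_{L_2(\Omega)}\le\delta_{\mathcal I_1}$ with a noise level $\delta_{\mathcal I_1}>0$. Let $\alpha=\alpha(\delta_{\mathcal I_1})>0$ be chosen such that $$\alpha(\delta_{\mathcal I_1})\to 0\quad\text{and}\quad \frac{(\delta_{\mathcal I_1})^2}{\alpha(\delta_{\mathcal I_1})}\to 0\qquad\text{for }\delta_{\mathcal I_1}\to 0 .$$ Then every sequence $\{\mathbf a_k:=\mathbf a_{\alpha(\delta_k)}^{\delta_k}\}_{k\in\mathbb N}$, where $\delta_k\to 0$ as $k\to\infty$ (with noisy images $\mathcal I_1^{\delta_k}$ of noise level $\delta_{\mathcal I_1}=\delta_k$) and where $\mathbf a_k$ is a minimizer over $\mathcal M$ of $$\mathbf a\mapsto \|\mathcal F(\mathbf a)-\mathcal I_1^{\delta_k}\|_{L_2(\Omega)}^2+\alpha(\delta_k)\|\mathbf a-\mathbf a_0\|_X^2,$$ has a convergent subsequence. Furthermore, the limit of every convergent subsequence is an $\mathbf a_0$-minimum-norm-solution. Moreover, if the $\mathbf a_0$-minimum-norm-solution $\mathbf a^\dagger$ is unique, then $\lim_{\delta_k\to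 0}\mathbf a_{\alpha(\delta_k)}^{\delta_k}=\mathbf a^\dagger$.
   Context: Setting. Material parameter vectors are functions $\mathbf a:\Omega_1\to\mathbb R^n$, and $\mathcal M$ is a predefined admissible set of them. For $\mathbf a\in\mathcal M$ the displacement $\mathbf u=\mathbf u(\cdot,\mathbf a):\Omega_1\to\mathbb R^2$ (also written $\mathbf u(\mathbf a)$) is determined by a set of equations $\mathcal L(\mathbf a,\mathbf u)=\mathbf f$ in $\Omega_1$, $\mathcal B(\mathbf a,\mathbf u)=\mathbf h$ on $\partial\Omega_1\setminus\Gamma_D$, $\mathbf u=\mathbf g$ on $\Gamma_D$ ($\Gamma_D=\emptyset$ or $\Gamma_D=\partial\Omega_1$ allowed); the concrete form of $\mathcal L,\mathcal B$ is arbitrary, only the unique solvability in (iv) below is required. The deformation is $G(\mathbf a)(\mathbf x):=\mathbf x+\mathbf u(\mathbf x,\mathbf a)$. Standing minimal assumptions: (i) $\Omega_1,\Omega_2\subset\mathbb R^2$ are open and bounded with Lipschitz continuous boundaries. (ii) $X$ is a separable Hilbert space, $\mathcal M\subseteq X$, $\mathbf a_0\in X$. (iii) $\mathcal I_1\in L_2(\Omega_1)$ and $\mathcal I_2\in L_\infty(\Omega_2)$ (real-valued images). (iv) For each $\mathbf a\in\mathcal M$ there is a unique solution $\mathbf u(\cdot,\mathbf a)\in L_2(\Omega_1)$ of the equations $\mathcal L(\mathbf a,\mathbf u)=\mathbf f$ in $\Omega_1$, $\mathcal B(\mathbf a,\mathbf u)=\mathbf h$ on $\partial\Omega_1\setminus\Gamma_D$,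 $\mathbf u=\mathbf g$ on $\Gamma_D$. (v) $\Omega\subset\Omega_1$ is bounded and open with Lipschitz continuous boundary, and $G(\mathbf a)(\mathbf x)\in\Omega_2$ for all $\mathbf a\in\mathcal M$, $\mathbf x\in\Omega$. Definitions. An $\mathbf a_0$-minimum-norm-solution (MNS) is an $\mathbf a^*\in\mathcal M$ with $\mathcal I_2\circ G(\mathbf a^* )=\mathcal I_1$ (on $\Omega$) and $\|\mathbf a^*-\mathbf a_0\|_X=\min_{\mathbf a\in\mathcal M}\{\|\mathbf a-\mathbf a_0\|_X : \mathcal I_2\circ G(\mathbf a)=\mathcal I_1\}$. $\mathcal F$ is weakly sequentially closed if $\mathbf a_j\in\mathcal M$, $\mathbf a_j\rightharpoonup\mathbf a$ in $X$ and $\mathcal F(\mathbf a_j)\rightharpoonup y$ in $L_2(\Omega)$ imply $\mathbf a\in\mathcal M$ and $\mathcal F(\mathbf a)=y$. *)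

theory Defs
  imports "HOL-Analysis.Analysis"
begin

text \<open>
  The open set \<open>S\<close> has a Lipschitz boundary if near every boundary point, and in suitably rotated
  (or reflected) Cartesian coordinates, it is the strict epigraph of a Lipschitz function of one
  variable.
\<close>

definition lipschitz_boundary :: "(real^2) set \<Rightarrow> bool" where
  "lipschitz_boundary S \<longleftrightarrow>
     (\<forall>p\<in>frontier S. \<exists>(R :: real^2 \<Rightarrow> real^2) (\<phi> :: real \<Rightarrow> real) C r. orthogonal_transformation R \<and> C-lipschitz_on UNIV \<phi> \<and> r > 0 \<and>
        (\<forall>x\<in>ball p r. x \<in> S \<longleftrightarrow> \<phi> (R x $ 1) < R x $ 2))"

definition lipschitz_domain :: "(real^2) set \<Rightarrow> bool" where
  "lipschitz_domain S \<longleftrightarrow> open S \<and> bounded S \<and> lipschitz_boundary S"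

text \<open>
  Elements of \<open>L\<^sub>2\<close> and \<open>L\<^sub>\<infinity>\<close> are represented by functions on the whole space of which only the
  values on \<open>S\<close> matter; equality in \<open>L\<^sub>2(S)\<close> is equality almost everywhere on \<open>S\<close>.
\<close>

definition L2 :: "'a::euclidean_space set \<Rightarrow> ('a \<Rightarrow> 'b::euclidean_space) set" where
  "L2 S = {f. f \<in> borel_measurable (lebesgue_on S) \<and>
              integrable (lebesgue_on S) (\<lambda>x. (norm (f x))\<^sup>2)}"

definition L2_norm :: "'a::euclidean_space set \<Rightarrow> ('a \<Rightarrow> 'b::euclidean_space) \<Rightarrow> real" where
  "L2_norm S f = sqrt (integral\<^sup>L (lebesgue_on S) (\<lambda>x. (norm (f x))\<^sup>2))"

definition L2_eq :: "'a::euclidean_space set \<Rightarrow> ('a \<Rightarrow> 'b) \<Rightarrow> ('a \<Rightarrow> 'b) \<Rightarrow> bool" where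
  "L2_eq S f g \<longleftrightarrow> (AE x in lebesgue_on S. f x = g x)"

definition Linf :: "'a::euclidean_space set \<Rightarrow> ('a \<Rightarrow> real) set" where
  "Linf S = {f. f \<in> borel_measurable (lebesgue_on S) \<and> (\<exists>C. AE x in lebesgue_on S. \<bar>f x\<bar> \<le> C)}"

text \<open>
  Boundedness forces such a functional to take the same value on functions that agree almost
  everywhere on \<open>S\<close>, so these are exactly the elements of the dual space of \<open>L\<^sub>2(S)\<close>.
\<close>

definition L2_dual :: "'a::euclidean_space set \<Rightarrow> (('a \<Rightarrow> real) \<Rightarrow> real) set" where
  "L2_dual S = {\<phi>. (\<forall>f\<in>L2 S. \<forall>g\<in>L2 S. \<phi> (\<lambda>x. f x + g x) = \<phi> f + \<phi> g) \<and>
                   (\<forall>c. \<forall>f\<in>L2 S. \<phi> (\<lambda>x. c * f x) = c * \<phi> f) \<and>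
                   (\<exists>C. \<forall>f\<in>L2 S. \<bar>\<phi> f\<bar> \<le> C * L2_norm S f)}"

definition L2_weakly_converges ::
  "'a::euclidean_space set \<Rightarrow> (nat \<Rightarrow> 'a \<Rightarrow> real) \<Rightarrow> ('a \<Rightarrow> real) \<Rightarrow> bool" where
  "L2_weakly_converges S f g \<longleftrightarrow>
     (\<forall>j. f j \<in> L2 S) \<and> g \<in> L2 S \<and> (\<forall>\<phi>\<in>L2_dual S. (\<lambda>j. \<phi> (f j)) \<longlonglongrightarrow> \<phi> g)"

definition weakly_converges :: "(nat \<Rightarrow> 'x::real_normed_vector) \<Rightarrow> 'x \<Rightarrow> bool" where
  "weakly_converges a l \<longleftrightarrow>
     (\<forall>\<phi> :: 'x \<Rightarrow> real. bounded_linear \<phi> \<longrightarrow> (\<lambda>j. \<phi> (a j)) \<longlonglongrightarrow> \<phi> l)"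

definition L2_continuous_operator ::
  "'a::euclidean_space set \<Rightarrow> 'x::real_normed_vector set \<Rightarrow> ('x \<Rightarrow> 'a \<Rightarrow> real) \<Rightarrow> bool" where
  "L2_continuous_operator S M F \<longleftrightarrow>
     (\<forall>a\<in>M. ((\<lambda>b. L2_norm S (\<lambda>x. F b x - F a x)) \<longlongrightarrow> 0) (at a within M))"

definition weakly_sequentially_closed ::
  "'a::euclidean_space set \<Rightarrow> 'x::real_normed_vector set \<Rightarrow> ('x \<Rightarrow> 'a \<Rightarrow> real) \<Rightarrow> bool" where
  "weakly_sequentially_closed S M F \<longleftrightarrow>
     (\<forall>a l y. (\<forall>j. a j \<in> M) \<and> weakly_converges a l \<and> L2_weakly_converges S (\<lambda>j. F (a j)) y
        \<longrightarrow> l \<in> M \<and> L2_eq S (F l) y)"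

text \<open>
  The equations for the displacement belonging to the material parameter function \<open>p\<close>. The
  operators \<open>L\<close> and \<open>B\<close> are arbitrary and have arbitrary codomains, so that nonlinear equations
  and weak forms are covered. The operator \<open>tr\<close> assigns boundary values to a displacement
  (a trace operator, or the identity when displacements are functions on the closed domain).
\<close>

definition solves_displacement_eqs ::
  "(real^2) set \<Rightarrow> (real^2) set \<Rightarrow>
   ((real^2 \<Rightarrow> real^'n) \<Rightarrow> (real^2 \<Rightarrow> real^2) \<Rightarrow> real^2 \<Rightarrow> 'f) \<Rightarrow>
   ((real^2 \<Rightarrow> real^'n) \<Rightarrow> (real^2 \<Rightarrow> real^2) \<Rightarrow> real^2 \<Rightarrow> 'h) \<Rightarrow>
   ((real^2 \<Rightarrow> real^2) \<Rightarrow> real^2 \<Rightarrow> real^2) \<Rightarrow>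
   (real^2 \<Rightarrow> 'f) \<Rightarrow> (real^2 \<Rightarrow> 'h) \<Rightarrow> (real^2 \<Rightarrow> real^2) \<Rightarrow>
   (real^2 \<Rightarrow> real^'n) \<Rightarrow> (real^2 \<Rightarrow> real^2) \<Rightarrow> bool" where
  "solves_displacement_eqs \<Omega>1 \<Gamma>D L B tr f h g p v \<longleftrightarrow>
     (\<forall>x\<in>\<Omega>1. L p v x = f x) \<and>
     (\<forall>x\<in>frontier \<Omega>1 - \<Gamma>D. B p v x = h x) \<and>
     (\<forall>x\<in>\<Gamma>D. tr v x = g x)"

definition is_unique_L2_solution ::
  "(real^2) set \<Rightarrow> ((real^2 \<Rightarrow> real^2) \<Rightarrow> bool) \<Rightarrow> (real^2 \<Rightarrow> real^2) \<Rightarrow> bool" where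
  "is_unique_L2_solution S P v \<longleftrightarrow> v \<in> L2 S \<and> P v \<and> (\<forall>w\<in>L2 S. P w \<longrightarrow> L2_eq S w v)"

definition deformation :: "('x \<Rightarrow> real^2 \<Rightarrow> real^2) \<Rightarrow> 'x \<Rightarrow> real^2 \<Rightarrow> real^2" where
  "deformation u a x = x + u a x"

definition image_operator ::
  "(real^2 \<Rightarrow> real) \<Rightarrow> ('x \<Rightarrow> real^2 \<Rightarrow> real^2) \<Rightarrow> 'x \<Rightarrow> real^2 \<Rightarrow> real" where
  "image_operator I2 u a = I2 \<circ> deformation u a"

definition is_minimum_norm_solution ::
  "'a::euclidean_space set \<Rightarrow> 'x::real_normed_vector set \<Rightarrow> ('x \<Rightarrow> 'a \<Rightarrow> real) \<Rightarrow>
   ('a \<Rightarrow> real) \<Rightarrow> 'x \<Rightarrow> 'x \<Rightarrow> bool" where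
  "is_minimum_norm_solution S M F I1 a0 a \<longleftrightarrow>
     is_arg_min (\<lambda>b. norm (b - a0)) (\<lambda>b. b \<in> M \<and> L2_eq S (F b) I1) a"

definition tikhonov ::
  "'a::euclidean_space set \<Rightarrow> ('x::real_normed_vector \<Rightarrow> 'a \<Rightarrow> real) \<Rightarrow> ('a \<Rightarrow> real) \<Rightarrow>
   real \<Rightarrow> 'x \<Rightarrow> 'x \<Rightarrow> real" where
  "tikhonov S F J \<alpha> a0 a = (L2_norm S (\<lambda>x. F a x - J x))\<^sup>2 + \<alpha> * (norm (a - a0))\<^sup>2"

end

theory Submission
  imports Defs
begin

text \<open>
  Comparing the Tikhonov functional at \<open>a k\<close> and at a minimum-norm solution \<open>ad\<close> shows that
  \<open>F (a k)\<close> tends to \<open>I1\<close> in \<open>L2\<close> and that \<open>(norm (a k - a0))\<^sup>2\<close> is at most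
  \<open>(\<delta> k)\<^sup>2 / \<alpha> (\<delta> k) + (norm (ad - a0))\<^sup>2\<close>. Bounded sequences in a separable Hilbert space have
  weakly convergent subsequences; closedness makes every weak limit a solution, and the norm bound
  forces it to have minimal norm and the convergence to be strong.
\<close>

section \<open>Weak convergence in Hilbert spaces\<close>

text \<open>The representing vector is the minimiser of \<open>(norm x)\<^sup>2 - 2 * \<phi> x\<close>.\<close>

lemma riesz_representation:
  fixes \<phi> :: "'x::{real_inner, banach} \<Rightarrow> real"
  assumes "bounded_linear \<phi>"
  shows "\<exists>z. \<forall>y. \<phi> y = z \<bullet> y"
proof -
  interpret bounded_linear \<phi> by fact
  obtain K where K: "\<And>x. norm (\<phi> x) \<le> norm x * K"
    using bounded by blast
  define J where "J x = (norm x)\<^sup>2 - 2 * \<phi> x" for x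
  define m where "m = Inf (range J)"
  \<comment> \<open>Completing the square: \<open>J x\<close> is at least
    \<open>(norm x - K)\<^sup>2 - K\<^sup>2\<close>.\<close>
  have J_lower: "- K\<^sup>2 \<le> J x" for x
  proof -
    have "0 \<le> (norm x - K)\<^sup>2" by simp
    moreover have "\<phi> x \<le> norm x * K" using K[of x] by simp
    ultimately show ?thesis by (simp add: J_def power2_diff)
  qed
  then have bdd: "bdd_below (range J)" by (rule bdd_belowI2)
  have m_le: "m \<le> J x" for x
    unfolding m_def by (rule cInf_lower[OF _ bdd]) simp
  have "\<exists>x. J x < m + 1 / real (Suc n)" for n
    using cInf_lessD[of "range J" "m + 1 / real (Suc n)"] by (auto simp: m_def)
  then obtain s where s: "\<And>n. J (s n) < m + 1 / real (Suc n)" by metis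
  \<comment> \<open>The midpoint of \<open>x\<close> and \<open>y\<close> has \<open>J\<close>-value
    at least \<open>m\<close>. Combined with the parallelogram law this makes near-minimisers close
    to each other, so a minimising sequence is Cauchy without any compactness.\<close>
  have parallelogram: "(norm (x - y))\<^sup>2 \<le> 2 * (J x - m) + 2 * (J y - m)" for x y
  proof -
    have "\<phi> ((1/2) *\<^sub>R (x + y)) = (\<phi> x + \<phi> y) / 2"
      by (simp add: scaleR add)
    moreover have "(norm ((1/2) *\<^sub>R (x + y)))\<^sup>2 = (norm (x + y))\<^sup>2 / 4"
      by (simp add: power_mult_distrib power_divide)
    ultimately have "J ((1/2) *\<^sub>R (x + y)) = (norm (x + y))\<^sup>2 / 4 - (\<phi> x + \<phi> y)"
      by (simp add: J_def)
    moreover have "(norm (x + y))\<^sup>2 + (norm (x - y))\<^sup>2 = 2 * (norm x)\<^sup>2 + 2 * (norm y)\<^sup>2"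
      by (simp add: power2_norm_eq_inner algebra_simps inner_commute)
    ultimately show ?thesis
      using m_le[of "(1/2) *\<^sub>R (x + y)"] by (simp add: J_def)
  qed
  have "Cauchy s"
  proof (rule metric_CauchyI)
    fix e :: real assume "0 < e"
    \<comment> \<open>Two \<open>J\<close>-gaps below \<open>e\<^sup>2 / 4\<close> give, through
      \<open>parallelogram\<close>, a squared distance below \<open>e\<^sup>2\<close>.\<close>
    then obtain N where N: "1 / real (Suc N) < e\<^sup>2 / 4"
      using nat_approx_posE[of "e\<^sup>2 / 4"] by auto
    have J_near: "J (s n) - m < e\<^sup>2 / 4" if "n \<ge> N" for n
    proof -
      have "1 / real (Suc n) \<le> 1 / real (Suc N)" using that by (simp add: field_simps)
      with s[of n] N show ?thesis by linarith
    qed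
    have "dist (s i) (s j) < e" if "i \<ge> N" "j \<ge> N" for i j
    proof -
      have "(norm (s i - s j))\<^sup>2 < e\<^sup>2"
        using parallelogram[of "s i" "s j"] J_near[OF that(1)] J_near[OF that(2)] by argo
      then show ?thesis
        using \<open>0 < e\<close> by (simp add: dist_norm power2_less_imp_less)
    qed
    then show "\<exists>N. \<forall>i\<ge>N. \<forall>j\<ge>N. dist (s i) (s j) < e" by blast
  qed
  then obtain z where z: "s \<longlonglongrightarrow> z"
    using Cauchy_convergent convergent_def by blast
  have "(\<lambda>n. J (s n)) \<longlonglongrightarrow> J z"
    unfolding J_def by (intro tendsto_intros tendsto z)
  moreover have "(\<lambda>n. m + 1 / real (Suc n)) \<longlonglongrightarrow> m + 0"
    by (intro tendsto_add tendsto_const LIMSEQ_Suc[OF lim_1_over_n])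
  ultimately have "J z \<le> m + 0"
    by (rule LIMSEQ_le) (use s less_imp_le in blast)
  then have Jz: "J z \<le> J x" for x using m_le[of x] by simp
  have "\<phi> y = z \<bullet> y" for y
  proof (cases "y = 0")
    case False
    \<comment> \<open>\<open>2 * d\<close> is the derivative of \<open>J\<close> at \<open>z\<close>
      in direction \<open>y\<close>, and \<open>t\<close> is the step along \<open>y\<close> that
      minimises \<open>J\<close>. The resulting decrease \<open>d\<^sup>2 / (norm y)\<^sup>2\<close>
      must vanish because \<open>z\<close> is already a minimiser.\<close>
    define d where "d = z \<bullet> y - \<phi> y"
    define t where "t = - d / (norm y)\<^sup>2"
    have "J (z + t *\<^sub>R y) = J z + (2 * t * d + t\<^sup>2 * (norm y)\<^sup>2)"
      unfolding J_def d_def power2_norm_eq_inner add scaleR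
      by (simp add: inner_commute algebra_simps power2_eq_square)
    also have "2 * t * d + t\<^sup>2 * (norm y)\<^sup>2 = - (d\<^sup>2 / (norm y)\<^sup>2)"
      using False by (simp add: t_def field_simps power2_eq_square)
    finally have "d\<^sup>2 / (norm y)\<^sup>2 \<le> 0"
      using Jz[of "z + t *\<^sub>R y"] by simp
    then have "d\<^sup>2 \<le> 0" using False by (simp add: divide_le_0_iff)
    then have "d = 0" by simp
    then show ?thesis by (simp add: d_def)
  qed simp
  then show ?thesis by blast
qed

text \<open>By Riesz, the bounded functionals are exactly the inner products with fixed
  vectors.\<close>

lemma weakly_converges_iff_inner:
  fixes a :: "nat \<Rightarrow> 'x::{real_inner, banach}"
  shows "weakly_converges a l \<longleftrightarrow> (\<forall>y. (\<lambda>j. a j \<bullet> y) \<longlonglongrightarrow> l \<bullet> y)"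
proof
  assume "weakly_converges a l"
  then show "\<forall>y. (\<lambda>j. a j \<bullet> y) \<longlonglongrightarrow> l \<bullet> y"
    unfolding weakly_converges_def using bounded_linear_inner_left by blast
next
  assume conv: "\<forall>y. (\<lambda>j. a j \<bullet> y) \<longlonglongrightarrow> l \<bullet> y"
  show "weakly_converges a l"
    unfolding weakly_converges_def
  proof (intro allI impI)
    fix \<phi> :: "'x \<Rightarrow> real"
    assume "bounded_linear \<phi>"
    then obtain z where "\<And>y. \<phi> y = z \<bullet> y" using riesz_representation by blast
    then show "(\<lambda>j. \<phi> (a j)) \<longlonglongrightarrow> \<phi> l"
      using conv by (simp add: inner_commute[of z])
  qed
qed

lemma tendsto_imp_weakly_converges: "a \<longlonglongrightarrow> l \<Longrightarrow> weakly_converges a l"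
  unfolding weakly_converges_def by (auto intro: bounded_linear.tendsto)

text \<open>Tychonoff's theorem replaces the diagonal argument: a product of compact intervals over
  a countable index set is compact and first countable, hence sequentially compact.\<close>

lemma bounded_sequences_common_subseq:
  fixes f :: "nat \<Rightarrow> nat \<Rightarrow> real"
  assumes "\<And>n i. \<bar>f n i\<bar> \<le> C i"
  obtains r :: "nat \<Rightarrow> nat" where "strict_mono r" "\<And>i. convergent (\<lambda>n. f (r n) i)"
proof -
  have "compactin (product_topology (\<lambda>i. euclidean) UNIV) (Pi\<^sub>E UNIV (\<lambda>i. {- C i..C i}))"
    by (simp add: compactin_PiE)
  then have "compact (Pi\<^sub>E UNIV (\<lambda>i. {- C i..C i}))"
    by (simp add: euclidean_product_topology)
  then have "seq_compact (Pi\<^sub>E UNIV (\<lambda>i. {- C i..C i}))"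
    by (rule compact_imp_seq_compact)
  moreover have "\<forall>n. f n \<in> Pi\<^sub>E UNIV (\<lambda>i. {- C i..C i})"
    using assms by (auto simp: abs_le_iff minus_le_iff)
  ultimately obtain g r where r: "strict_mono r" and lim: "(f \<circ> r) \<longlonglongrightarrow> g"
    by (rule seq_compactE) auto
  have "(\<lambda>n. f (r n) i) \<longlonglongrightarrow> g i" for i
  proof -
    have "isCont (\<lambda>h::nat \<Rightarrow> real. h i) g"
      using iffD1[OF continuous_on_eq_continuous_at[OF open_UNIV]
          continuous_on_product_coordinates] by blast
    from isCont_tendsto_compose[OF this lim] show ?thesis by (simp add: o_def)
  qed
  with r show thesis by (intro that) (auto simp: convergent_def)
qed

text \<open>A subsequence is chosen along which the inner products with a countable dense set
  converge. Boundedness extends the convergence to all vectors, and the limit functional is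
  represented by the weak limit.\<close>

lemma bounded_weakly_convergent_subseq:
  fixes x :: "nat \<Rightarrow> 'x::{real_inner, banach}"
  assumes sep: "separable_space (euclidean :: 'x topology)"
    and bd: "\<And>n. norm (x n) \<le> K"
  obtains r :: "nat \<Rightarrow> nat" and l where "strict_mono r" "weakly_converges (x \<circ> r) l"
proof -
  obtain D :: "'x set" where D: "countable D" "closure D = UNIV"
    using sep by (auto simp: separable_space_def)
  then have "D \<noteq> {}" by auto
  then have range_D: "range (from_nat_into D) = D"
    using D(1) by (rule range_from_nat_into)
  have "\<bar>x n \<bullet> d\<bar> \<le> K * norm d" for n d
    using Cauchy_Schwarz_ineq2[of "x n" d] mult_right_mono[OF bd[of n], of "norm d"] by simp
  then obtain r :: "nat \<Rightarrow> nat" where r: "strict_mono r"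
    and conv_from_nat: "\<And>i. convergent (\<lambda>n. x (r n) \<bullet> from_nat_into D i)"
    using bounded_sequences_common_subseq[of "\<lambda>n i. x n \<bullet> from_nat_into D i"
        "\<lambda>i. K * norm (from_nat_into D i)"] by blast
  have conv_D: "convergent (\<lambda>n. x (r n) \<bullet> d)" if "d \<in> D" for d
    using conv_from_nat that range_D by (metis imageE)
  have K0: "0 \<le> K" using bd[of 0] norm_ge_zero order_trans by blast
  have conv: "convergent (\<lambda>n. x (r n) \<bullet> y)" for y
  proof -
    have "Cauchy (\<lambda>n. x (r n) \<bullet> y)"
    proof (rule metric_CauchyI)
      fix e :: real assume e: "0 < e"
      \<comment> \<open>Replacing \<open>y\<close> by \<open>d\<close> costs at most
        \<open>e / 3\<close> in each of the two inner products, which leaves \<open>e / 3\<close>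
        for the Cauchy property at \<open>d\<close>. Using \<open>K + 1\<close> keeps the
        denominator positive when \<open>K = 0\<close>.\<close>
      define \<eta> where "\<eta> = e / (3 * (K + 1))"
      have \<eta>: "0 < \<eta>" using e K0 by (simp add: \<eta>_def)
      have "y \<in> closure D" by (simp add: D(2))
      then obtain d where d: "d \<in> D" "dist d y < \<eta>"
        using \<eta> closure_approachable by blast
      have "K * norm (y - d) \<le> (K + 1) * \<eta>"
        using d(2) K0 by (intro mult_mono) (auto simp: dist_norm norm_minus_commute)
      also have "\<dots> = e / 3" using K0 by (simp add: \<eta>_def field_simps)
      finally have small: "\<bar>x n \<bullet> (y - d)\<bar> \<le> e / 3" for n
        using Cauchy_Schwarz_ineq2[of "x n" "y - d"]
          mult_right_mono[OF bd[of n], of "norm (y - d)"] by simp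
      obtain N where N: "\<And>i j. i \<ge> N \<Longrightarrow> j \<ge> N \<Longrightarrow> dist (x (r i) \<bullet> d) (x (r j) \<bullet> d) < e / 3"
        using convergent_Cauchy[OF conv_D[OF d(1)]] e
        by (metis metric_CauchyD zero_less_divide_iff zero_less_numeral)
      have "dist (x (r i) \<bullet> y) (x (r j) \<bullet> y) < e" if "i \<ge> N" "j \<ge> N" for i j
        using N[OF that] small[of "r i"] small[of "r j"]
        unfolding dist_real_def inner_diff_right by linarith
      then show "\<exists>N. \<forall>i\<ge>N. \<forall>j\<ge>N. dist (x (r i) \<bullet> y) (x (r j) \<bullet> y) < e" by blast
    qed
    then show ?thesis by (rule Cauchy_convergent)
  qed
  \<comment> \<open>Linearity and the Cauchy-Schwarz bound pass to the pointwise limit, so Riesz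
    applies to \<open>\<psi>\<close>.\<close>
  define \<psi> where "\<psi> y = lim (\<lambda>n. x (r n) \<bullet> y)" for y
  have \<psi>: "(\<lambda>n. x (r n) \<bullet> y) \<longlonglongrightarrow> \<psi> y" for y
    using conv[of y] by (simp add: \<psi>_def convergent_LIMSEQ_iff)
  have "bounded_linear \<psi>"
  proof (rule bounded_linear_intro[where K = K])
    show "\<psi> (y + z) = \<psi> y + \<psi> z" for y z
      using \<psi>[of "y + z"] tendsto_add[OF \<psi>[of y] \<psi>[of z]]
      by (auto simp: inner_add_right intro: LIMSEQ_unique)
    show "\<psi> (c *\<^sub>R y) = c *\<^sub>R \<psi> y" for c y
      using \<psi>[of "c *\<^sub>R y"] tendsto_mult_left[OF \<psi>[of y], of c]
      by (auto intro: LIMSEQ_unique)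
    show "norm (\<psi> y) \<le> norm y * K" for y
    proof (rule LIMSEQ_le_const2[OF tendsto_norm[OF \<psi>]], intro exI allI impI)
      fix n
      show "norm (x (r n) \<bullet> y) \<le> norm y * K"
        using Cauchy_Schwarz_ineq2[of "x (r n)" y] mult_right_mono[OF bd[of "r n"], of "norm y"]
        by (simp add: mult.commute)
    qed
  qed
  then obtain l where "\<And>y. \<psi> y = l \<bullet> y" using riesz_representation by blast
  then have "weakly_converges (x \<circ> r) l"
    using \<psi> by (simp add: weakly_converges_iff_inner)
  with r show thesis by (rule that)
qed

text \<open>If convergence fails, infinitely many terms keep a distance of at least some
  \<open>e\<close> from \<open>l\<close>; enumerating them gives a subsequence none of whose
  subsequences tends to \<open>l\<close>.\<close>

lemma tendsto_of_subseq_tendsto: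
  fixes a :: "nat \<Rightarrow> 'x::metric_space"
  assumes "\<And>r :: nat \<Rightarrow> nat. strict_mono r \<Longrightarrow> \<exists>s :: nat \<Rightarrow> nat. strict_mono s \<and> (a \<circ> r \<circ> s) \<longlonglongrightarrow> l"
  shows "a \<longlonglongrightarrow> l"
proof (rule ccontr)
  assume "\<not> a \<longlonglongrightarrow> l"
  then obtain e where e: "0 < e" and far: "\<exists>\<^sub>F n in sequentially. \<not> dist (a n) l < e"
    by (auto simp: tendsto_iff not_eventually)
  have "infinite {n. \<not> dist (a n) l < e}"
    using far by (simp add: frequently_cofinite flip: cofinite_eq_sequentially)
  then obtain r :: "nat \<Rightarrow> nat" where r: "strict_mono r" "\<And>n. \<not> dist (a (r n)) l < e"
    using infinite_enumerate by blast
  from assms[OF r(1)] obtain s :: "nat \<Rightarrow> nat" where "(a \<circ> r \<circ> s) \<longlonglongrightarrow> l" by blast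
  then have "\<forall>\<^sub>F n in sequentially. dist ((a \<circ> r \<circ> s) n) l < e"
    using e tendstoD by blast
  then show False using r(2) by (simp add: eventually_False)
qed

section \<open>Square integrable functions\<close>

lemma L2_norm_nonneg [simp]: "0 \<le> L2_norm S f"
  by (simp add: L2_norm_def)

lemma L2_norm_square: "(L2_norm S f)\<^sup>2 = integral\<^sup>L (lebesgue_on S) (\<lambda>x. (norm (f x))\<^sup>2)"
  by (simp add: L2_norm_def)

text \<open>Stands in for Minkowski's inequality: this pointwise bound supplies the integrable
  majorant for differences and integrates to a triangle estimate for squared \<open>L2\<close>
  norms.\<close>

lemma power2_norm_diff_le:
  fixes x y :: "'b::real_normed_vector"
  shows "(norm (x - y))\<^sup>2 \<le> 2 * (norm x)\<^sup>2 + 2 * (norm y)\<^sup>2"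
proof -
  have "(norm (x - y))\<^sup>2 \<le> (norm x + norm y)\<^sup>2"
    by (intro power_mono norm_triangle_ineq4) simp
  moreover have "0 \<le> (norm x - norm y)\<^sup>2" by simp
  ultimately show ?thesis by (simp add: power2_sum power2_diff)
qed

lemma L2_diff:
  assumes "f \<in> L2 S" "g \<in> L2 S"
  shows "(\<lambda>x. f x - g x) \<in> L2 S"
proof -
  have "integrable (lebesgue_on S) (\<lambda>x. 2 * (norm (f x))\<^sup>2 + 2 * (norm (g x))\<^sup>2)"
    using assms by (simp add: L2_def)
  then have "integrable (lebesgue_on S) (\<lambda>x. (norm (f x - g x))\<^sup>2)"
    by (rule Bochner_Integration.integrable_bound)
      (use assms in \<open>auto simp: L2_def intro!: power2_norm_diff_le\<close>)
  then show ?thesis using assms by (auto simp: L2_def)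
qed

lemma L2_norm_diff_square_le:
  assumes "f \<in> L2 S" "g \<in> L2 S" "h \<in> L2 S"
  shows "(L2_norm S (\<lambda>x. f x - h x))\<^sup>2
    \<le> 2 * (L2_norm S (\<lambda>x. f x - g x))\<^sup>2 + 2 * (L2_norm S (\<lambda>x. h x - g x))\<^sup>2"
proof -
  have int: "integrable (lebesgue_on S) (\<lambda>x. (norm (f' x - g' x))\<^sup>2)"
    if "f' \<in> L2 S" "g' \<in> L2 S" for f' g' :: "'a \<Rightarrow> 'b"
    using L2_diff[OF that] by (simp add: L2_def)
  have "(L2_norm S (\<lambda>x. f x - h x))\<^sup>2
      \<le> integral\<^sup>L (lebesgue_on S) (\<lambda>x. 2 * (norm (f x - g x))\<^sup>2 + 2 * (norm (h x - g x))\<^sup>2)"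
    unfolding L2_norm_square
  proof (rule integral_mono)
    \<comment> \<open>\<open>f x - h x\<close> is the difference of \<open>f x - g x\<close> and
      \<open>h x - g x\<close>.\<close>
    show "(norm (f x - h x))\<^sup>2 \<le> 2 * (norm (f x - g x))\<^sup>2 + 2 * (norm (h x - g x))\<^sup>2" for x
      using power2_norm_diff_le[of "f x - g x" "h x - g x"] by simp
  qed (use int assms in simp_all)
  also have "\<dots> = 2 * (L2_norm S (\<lambda>x. f x - g x))\<^sup>2 + 2 * (L2_norm S (\<lambda>x. h x - g x))\<^sup>2"
    using int assms by (simp add: L2_norm_square)
  finally show ?thesis .
qed

lemma L2_norm_diff_cong:
  assumes "L2_eq S f g" "f \<in> L2 S" "g \<in> L2 S" "h \<in> L2 S"
  shows "L2_norm S (\<lambda>x. f x - h x) = L2_norm S (\<lambda>x. g x - h x)"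
proof -
  have "integral\<^sup>L (lebesgue_on S) (\<lambda>x. (norm (f x - h x))\<^sup>2)
      = integral\<^sup>L (lebesgue_on S) (\<lambda>x. (norm (g x - h x))\<^sup>2)"
    by (rule integral_cong_AE) (use assms in \<open>auto simp: L2_eq_def L2_def\<close>)
  then show ?thesis by (simp add: L2_norm_def)
qed

text \<open>Needed because the exact image is given on \<open>\<Omega>1\<close>, while the data
  misfit is measured on \<open>\<Omega>\<close>.\<close>

lemma L2_subset:
  assumes "f \<in> L2 S" "T \<subseteq> S" "S \<in> sets lebesgue" "T \<in> sets lebesgue"
  shows "f \<in> L2 T"
proof -
  have "set_integrable lebesgue S (\<lambda>x. (norm (f x))\<^sup>2)"
    using assms by (simp add: L2_def set_integrable_def integrable_restrict_space)
  then have "set_integrable lebesgue T (\<lambda>x. (norm (f x))\<^sup>2)"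
    by (rule set_integrable_subset) (use assms in auto)
  then have "integrable (lebesgue_on T) (\<lambda>x. (norm (f x))\<^sup>2)"
    using assms by (simp add: set_integrable_def integrable_restrict_space)
  moreover have "f \<in> borel_measurable (lebesgue_on T)"
    by (rule measurable_restrict_mono[OF _ \<open>T \<subseteq> S\<close>]) (use assms(1) in \<open>simp add: L2_def\<close>)
  ultimately show ?thesis by (simp add: L2_def)
qed

text \<open>Makes closedness applicable: it speaks of weak convergence of the images, whereas the
  Tikhonov estimate yields norm convergence. The bound of each functional by the norm
  suffices.\<close>

lemma L2_weakly_convergesI:
  assumes f: "\<And>j. f j \<in> L2 S" and g: "g \<in> L2 S"
    and lim: "(\<lambda>j. L2_norm S (\<lambda>x. f j x - g x)) \<longlonglongrightarrow> 0"
  shows "L2_weakly_converges S f g"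
  unfolding L2_weakly_converges_def
proof (intro conjI ballI allI f g)
  fix \<phi> assume \<phi>: "\<phi> \<in> L2_dual S"
  then obtain C where C: "\<And>f. f \<in> L2 S \<Longrightarrow> \<bar>\<phi> f\<bar> \<le> C * L2_norm S f"
    unfolding L2_dual_def by blast
  have additive: "\<forall>f\<in>L2 S. \<forall>g\<in>L2 S. \<phi> (\<lambda>x. f x + g x) = \<phi> f + \<phi> g"
    using \<phi> unfolding L2_dual_def by blast
  have add: "\<phi> (\<lambda>x. (f j x - g x) + g x) = \<phi> (\<lambda>x. f j x - g x) + \<phi> g" for j
    using bspec[OF bspec[OF additive L2_diff[OF f g]] g] .
  have le: "\<bar>\<phi> (f j) - \<phi> g\<bar> \<le> C * L2_norm S (\<lambda>x. f j x - g x)" for j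
    using add[of j] C[OF L2_diff[OF f g, of j]] by simp
  have "(\<lambda>j. \<phi> (f j) - \<phi> g) \<longlonglongrightarrow> 0"
    by (rule Lim_null_comparison[OF _ tendsto_mult_right_zero[OF lim, of C]]) (use le in simp)
  then show "(\<lambda>j. \<phi> (f j)) \<longlonglongrightarrow> \<phi> g" by (rule LIM_zero_cancel)
qed

section \<open>Tikhonov regularisation\<close>

text \<open>The exact solution \<open>ad\<close> is an admissible competitor, and its data misfit is
  just the noise.\<close>

lemma tikhonov_minimizer_bound:
  assumes F: "\<And>b. b \<in> M \<Longrightarrow> F b \<in> L2 S" and I: "I \<in> L2 S" and J: "J \<in> L2 S"
    and ad: "ad \<in> M" "L2_eq S (F ad) I"
    and noise: "L2_norm S (\<lambda>x. I x - J x) \<le> d"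
    and min: "is_arg_min (tikhonov S F J \<alpha> a0) (\<lambda>b. b \<in> M) a"
  shows "(L2_norm S (\<lambda>x. F a x - J x))\<^sup>2 + \<alpha> * (norm (a - a0))\<^sup>2
    \<le> d\<^sup>2 + \<alpha> * (norm (ad - a0))\<^sup>2"
proof -
  have "tikhonov S F J \<alpha> a0 a \<le> tikhonov S F J \<alpha> a0 ad"
    using min ad(1) by (auto simp: is_arg_min_linorder)
  moreover have "(L2_norm S (\<lambda>x. F ad x - J x))\<^sup>2 \<le> d\<^sup>2"
    using L2_norm_diff_cong[OF ad(2) F[OF ad(1)] I J] noise by (simp add: power_mono)
  ultimately show ?thesis by (simp add: tikhonov_def)
qed

text \<open>
  The norm bound makes the weak limit \<open>l\<close> a minimum-norm solution with
  \<open>norm (a j - a0) \<longlonglongrightarrow> norm (l - a0)\<close>, which upgrades weak to strong convergence.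
\<close>

lemma weak_limit_minimum_norm_solution:
  fixes a :: "nat \<Rightarrow> 'x::{real_inner, banach}"
  assumes F: "\<And>b. b \<in> M \<Longrightarrow> F b \<in> L2 S" and I: "I \<in> L2 S"
    and closed: "weakly_sequentially_closed S M F"
    and ad: "is_minimum_norm_solution S M F I a0 ad"
    and a: "\<And>j. a j \<in> M"
    and residual: "(\<lambda>j. L2_norm S (\<lambda>x. F (a j) x - I x)) \<longlonglongrightarrow> 0"
    and bound: "\<And>j. (norm (a j - a0))\<^sup>2 \<le> c j"
    and c: "c \<longlonglongrightarrow> (norm (ad - a0))\<^sup>2"
    and weak: "weakly_converges a l"
  shows "is_minimum_norm_solution S M F I a0 l" and "a \<longlonglongrightarrow> l"
proof -
  have "L2_weakly_converges S (\<lambda>j. F (a j)) I"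
    using F[OF a] I residual by (rule L2_weakly_convergesI)
  then have l: "l \<in> M" "L2_eq S (F l) I"
    using closed a weak unfolding weakly_sequentially_closed_def by blast+
  have ad_le: "norm (ad - a0) \<le> norm (b - a0)" if "b \<in> M" "L2_eq S (F b) I" for b
    using ad that by (simp add: is_minimum_norm_solution_def is_arg_min_linorder)
  \<comment> \<open>Expand \<open>(norm ((a j - a0) - (l - a0)))\<^sup>2\<close> and replace the
    term quadratic in \<open>a j\<close> by its bound \<open>c j\<close>. What remains is affine in
    \<open>a j\<close>, so weak convergence determines the limit of \<open>e\<close>.\<close>
  define e where "e j = c j - 2 * (a j \<bullet> (l - a0) - a0 \<bullet> (l - a0)) + (norm (l - a0))\<^sup>2" for j
  have dist_le: "(norm (a j - l))\<^sup>2 \<le> e j" for j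
  proof -
    have "(norm (a j - l))\<^sup>2 = (norm ((a j - a0) - (l - a0)))\<^sup>2" by simp
    also have "\<dots> = (norm (a j - a0))\<^sup>2 - 2 * ((a j - a0) \<bullet> (l - a0)) + (norm (l - a0))\<^sup>2"
      by (simp only: power2_norm_eq_inner inner_diff_left inner_diff_right inner_commute)
        (simp add: algebra_simps inner_commute)
    finally show ?thesis using bound[of j] by (simp add: e_def inner_diff_left)
  qed
  have e_nonneg: "0 \<le> e j" for j
    using order_trans[OF zero_le_power2 dist_le] .
  have "e \<longlonglongrightarrow> (norm (ad - a0))\<^sup>2 - 2 * (l \<bullet> (l - a0) - a0 \<bullet> (l - a0)) + (norm (l - a0))\<^sup>2"
    unfolding e_def using weak c
    by (intro tendsto_add tendsto_diff tendsto_mult tendsto_const)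
      (simp_all add: weakly_converges_iff_inner)
  then have e: "e \<longlonglongrightarrow> (norm (ad - a0))\<^sup>2 - (norm (l - a0))\<^sup>2"
    by (simp add: power2_norm_eq_inner algebra_simps inner_commute)
  \<comment> \<open>Being nonnegative in the limit, \<open>e\<close> already yields the inequality
    that weak lower semicontinuity of the norm would give. Since \<open>l\<close> is itself a
    solution, equality follows, so \<open>e\<close> tends to 0 and squeezes the distances.\<close>
  then have "0 \<le> (norm (ad - a0))\<^sup>2 - (norm (l - a0))\<^sup>2"
    by (rule LIMSEQ_le_const) (use e_nonneg in blast)
  then have "norm (l - a0) \<le> norm (ad - a0)"
    by (intro power2_le_imp_le[OF _ norm_ge_zero]) simp
  then have eq: "norm (l - a0) = norm (ad - a0)"
    using ad_le[OF l] by simp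
  show "is_minimum_norm_solution S M F I a0 l"
    using l ad_le eq by (simp add: is_minimum_norm_solution_def is_arg_min_linorder)
  have "(\<lambda>j. (norm (a j - l))\<^sup>2) \<longlonglongrightarrow> 0"
    by (rule Lim_null_comparison[where g = e]) (use dist_le e eq in auto)
  then have "(\<lambda>j. sqrt ((norm (a j - l))\<^sup>2)) \<longlonglongrightarrow> sqrt 0" by (rule tendsto_real_sqrt)
  then show "a \<longlonglongrightarrow> l" by (simp add: LIM_zero_iff tendsto_norm_zero_iff)
qed

theorem theorem4p1:
  fixes \<Omega> \<Omega>1 \<Omega>2 \<Gamma>D :: "(real^2) set"
    and M :: "'x::{real_inner, banach} set"
    and a0 :: 'x
    and par :: "'x \<Rightarrow> real^2 \<Rightarrow> real^'n"
    and L :: "(real^2 \<Rightarrow> real^'n) \<Rightarrow> (real^2 \<Rightarrow> real^2) \<Rightarrow> real^2 \<Rightarrow> 'f"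
    and B :: "(real^2 \<Rightarrow> real^'n) \<Rightarrow> (real^2 \<Rightarrow> real^2) \<Rightarrow> real^2 \<Rightarrow> 'h"
    and tr :: "(real^2 \<Rightarrow> real^2) \<Rightarrow> real^2 \<Rightarrow> real^2"
    and f :: "real^2 \<Rightarrow> 'f" and h :: "real^2 \<Rightarrow> 'h" and g :: "real^2 \<Rightarrow> real^2"
    and u :: "'x \<Rightarrow> real^2 \<Rightarrow> real^2"
    and I1 I2 :: "real^2 \<Rightarrow> real"
    and \<alpha> :: "real \<Rightarrow> real"
    and \<delta> :: "nat \<Rightarrow> real"
    and I1\<delta> :: "nat \<Rightarrow> real^2 \<Rightarrow> real"
    and a :: "nat \<Rightarrow> 'x"
  assumes domains: "lipschitz_domain \<Omega>1" "lipschitz_domain \<Omega>2" "lipschitz_domain \<Omega>" "\<Omega> \<subseteq> \<Omega>1"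
    and dirichlet_part: "\<Gamma>D \<subseteq> frontier \<Omega>1"
    and separable: "separable_space (euclidean :: 'x topology)"
    and images: "I1 \<in> L2 \<Omega>1" "I2 \<in> Linf \<Omega>2"
    and displacement: "\<And>b. b \<in> M \<Longrightarrow>
      is_unique_L2_solution \<Omega>1 (solves_displacement_eqs \<Omega>1 \<Gamma>D L B tr f h g (par b)) (u b)"
    and deformation_into: "\<And>b x. b \<in> M \<Longrightarrow> x \<in> \<Omega> \<Longrightarrow> deformation u b x \<in> \<Omega>2"
    and F_L2: "\<And>b. b \<in> M \<Longrightarrow> image_operator I2 u b \<in> L2 \<Omega>"
    and F_continuous: "L2_continuous_operator \<Omega> M (image_operator I2 u)"
    and F_closed: "weakly_sequentially_closed \<Omega> M (image_operator I2 u)"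
    and MNS_exists: "\<exists>b. is_minimum_norm_solution \<Omega> M (image_operator I2 u) I1 a0 b"
    and \<alpha>_pos: "\<And>d. d > 0 \<Longrightarrow> \<alpha> d > 0"
    and \<alpha>_lim: "(\<alpha> \<longlongrightarrow> 0) (at_right 0)" "((\<lambda>d. d\<^sup>2 / \<alpha> d) \<longlongrightarrow> 0) (at_right 0)"
    and \<delta>_pos: "\<And>k. \<delta> k > 0"
    and \<delta>_lim: "\<delta> \<longlonglongrightarrow> 0"
    and noisy_L2: "\<And>k. I1\<delta> k \<in> L2 \<Omega>"
    and noise_level: "\<And>k. L2_norm \<Omega> (\<lambda>x. I1 x - I1\<delta> k x) \<le> \<delta> k"
    and minimizer: "\<And>k. is_arg_min (tikhonov \<Omega> (image_operator I2 u) (I1\<delta> k) (\<alpha> (\<delta> k)) a0) (\<lambda>b. b \<in> M) (a k)"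
  shows "(\<exists>r. strict_mono (r :: nat \<Rightarrow> nat) \<and> convergent (a \<circ> r)) \<and>
    (\<forall>r l. strict_mono (r :: nat \<Rightarrow> nat) \<and> (a \<circ> r) \<longlonglongrightarrow> l
       \<longrightarrow> is_minimum_norm_solution \<Omega> M (image_operator I2 u) I1 a0 l) \<and>
    (\<forall>ad. is_minimum_norm_solution \<Omega> M (image_operator I2 u) I1 a0 ad \<and>
         (\<forall>b. is_minimum_norm_solution \<Omega> M (image_operator I2 u) I1 a0 b \<longrightarrow> b = ad)
       \<longrightarrow> a \<longlonglongrightarrow> ad)"
proof -
  let ?F = "image_operator I2 u"
  let ?mns = "is_minimum_norm_solution \<Omega> M ?F I1 a0"
  have I1: "I1 \<in> L2 \<Omega>"
    using images(1) domains by (intro L2_subset[of I1 \<Omega>1 \<Omega>]) (auto simp: lipschitz_domain_def)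
  have a: "a k \<in> M" for k using minimizer[of k] by (simp add: is_arg_min_def)
  have \<alpha>\<delta>_pos: "0 < \<alpha> (\<delta> k)" for k using \<alpha>_pos \<delta>_pos by blast
  \<comment> \<open>Positivity of the noise levels turns \<open>\<delta>_lim\<close> into
    convergence from the right, so both limits in \<open>\<alpha>_lim\<close> transfer to the
    sequence.\<close>
  have "filterlim \<delta> (at_right 0) sequentially"
    using \<delta>_lim \<delta>_pos by (simp add: filterlim_at less_imp_neq[OF \<delta>_pos, symmetric])
  note \<alpha>_seq_lim = filterlim_compose[OF \<alpha>_lim(1) this] filterlim_compose[OF \<alpha>_lim(2) this]

  obtain ad where ad: "?mns ad" using MNS_exists by blast
  then have ad': "ad \<in> M" "L2_eq \<Omega> (?F ad) I1"
    by (simp_all add: is_minimum_norm_solution_def is_arg_min_def)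
  \<comment> \<open>This is the right-hand side of \<open>key\<close> divided by
    \<open>\<alpha> (\<delta> k)\<close>; the condition on \<open>d\<^sup>2 / \<alpha> d\<close>
    removes the noise term in the limit.\<close>
  define c where "c k = (\<delta> k)\<^sup>2 / \<alpha> (\<delta> k) + (norm (ad - a0))\<^sup>2" for k
  have key: "(L2_norm \<Omega> (\<lambda>x. ?F (a k) x - I1\<delta> k x))\<^sup>2 + \<alpha> (\<delta> k) * (norm (a k - a0))\<^sup>2
      \<le> (\<delta> k)\<^sup>2 + \<alpha> (\<delta> k) * (norm (ad - a0))\<^sup>2" for k
    using F_L2 I1 noisy_L2 ad' noise_level minimizer by (rule tikhonov_minimizer_bound)
  have bound: "(norm (a k - a0))\<^sup>2 \<le> c k" for k
  proof -
    have "\<alpha> (\<delta> k) * (norm (a k - a0))\<^sup>2 \<le> (\<delta> k)\<^sup>2 + \<alpha> (\<delta> k) * (norm (ad - a0))\<^sup>2"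
      using key[of k] zero_le_power2[of "L2_norm \<Omega> (\<lambda>x. ?F (a k) x - I1\<delta> k x)"] by linarith
    then show ?thesis using \<alpha>\<delta>_pos[of k] by (simp add: c_def field_simps)
  qed
  have "c \<longlonglongrightarrow> 0 + (norm (ad - a0))\<^sup>2"
    unfolding c_def by (intro tendsto_add \<alpha>_seq_lim tendsto_const)
  then have c: "c \<longlonglongrightarrow> (norm (ad - a0))\<^sup>2" by simp
  have residual: "(\<lambda>k. L2_norm \<Omega> (\<lambda>x. ?F (a k) x - I1 x)) \<longlonglongrightarrow> 0"
  proof -
    \<comment> \<open>The first summand bounds twice the squared misfit to the noisy image, by
      \<open>key\<close> without its nonnegative penalty; the second bounds twice the squared noise.
      Here the condition that \<open>\<alpha>\<close> tends to 0 enters.\<close>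
    define e where "e k = 2 * ((\<delta> k)\<^sup>2 + \<alpha> (\<delta> k) * (norm (ad - a0))\<^sup>2) + 2 * (\<delta> k)\<^sup>2" for k
    have le: "(L2_norm \<Omega> (\<lambda>x. ?F (a k) x - I1 x))\<^sup>2 \<le> e k" for k
    proof -
      have "(L2_norm \<Omega> (\<lambda>x. I1 x - I1\<delta> k x))\<^sup>2 \<le> (\<delta> k)\<^sup>2"
        using noise_level by (simp add: power_mono)
      moreover have "0 \<le> \<alpha> (\<delta> k) * (norm (a k - a0))\<^sup>2"
        using \<alpha>\<delta>_pos[of k] by simp
      ultimately show ?thesis
        using L2_norm_diff_square_le[OF F_L2[OF a] noisy_L2 I1, of k k] key[of k]
        unfolding e_def by argo
    qed
    have "e \<longlonglongrightarrow> 2 * (0\<^sup>2 + 0 * (norm (ad - a0))\<^sup>2) + 2 * 0\<^sup>2"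
      unfolding e_def by (intro tendsto_intros \<delta>_lim \<alpha>_seq_lim)
    then have e: "e \<longlonglongrightarrow> 0" by simp
    have "(\<lambda>k. (L2_norm \<Omega> (\<lambda>x. ?F (a k) x - I1 x))\<^sup>2) \<longlonglongrightarrow> 0"
      by (rule Lim_null_comparison[OF _ e]) (use le in simp)
    then have "(\<lambda>k. sqrt ((L2_norm \<Omega> (\<lambda>x. ?F (a k) x - I1 x))\<^sup>2)) \<longlonglongrightarrow> sqrt 0"
      by (rule tendsto_real_sqrt)
    then show ?thesis by simp
  qed
  have weak_limit: "?mns l \<and> (a \<circ> r) \<longlonglongrightarrow> l"
    if r: "strict_mono r" and weak: "weakly_converges (a \<circ> r) l" for r :: "nat \<Rightarrow> nat" and l
  proof -
    have residual_r: "(\<lambda>j. L2_norm \<Omega> (\<lambda>x. ?F ((a \<circ> r) j) x - I1 x)) \<longlonglongrightarrow> 0"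
      using LIMSEQ_subseq_LIMSEQ[OF residual r] by (simp add: o_def)
    have a_r: "(a \<circ> r) j \<in> M" and bound_r: "(norm ((a \<circ> r) j - a0))\<^sup>2 \<le> (c \<circ> r) j" for j
      using a bound by simp_all
    show ?thesis
      using weak_limit_minimum_norm_solution[OF F_L2 I1 F_closed ad a_r residual_r bound_r
          LIMSEQ_subseq_LIMSEQ[OF c r] weak] by blast
  qed
  obtain K where K: "\<And>k. norm (a k) \<le> K"
  proof -
    obtain C where C: "\<And>k. norm (c k) \<le> C"
      using convergent_imp_Bseq[OF convergentI[OF c]] by (auto simp: Bseq_def)
    have "norm (a k) \<le> sqrt C + norm a0" for k
    proof -
      have "norm (a k - a0) \<le> sqrt C"
        using bound[of k] C[of k] by (intro real_le_rsqrt) simp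
      then show ?thesis using norm_triangle_sub[of "a k" a0] by linarith
    qed
    then show thesis by (rule that)
  qed
  \<comment> \<open>Stated for an arbitrary subsequence: \<open>r = id\<close> gives the first
    claim, and general \<open>r\<close> serves the uniqueness claim.\<close>
  have subseq: "\<exists>s l. strict_mono (s :: nat \<Rightarrow> nat) \<and> ?mns l \<and> (a \<circ> r \<circ> s) \<longlonglongrightarrow> l"
    if r: "strict_mono r" for r :: "nat \<Rightarrow> nat"
  proof -
    obtain s :: "nat \<Rightarrow> nat" and l
      where s: "strict_mono s" and "weakly_converges (a \<circ> r \<circ> s) l"
      using bounded_weakly_convergent_subseq[OF separable, of "a \<circ> r" K] K by auto
    then have "?mns l \<and> (a \<circ> r \<circ> s) \<longlonglongrightarrow> l"
      using weak_limit[of "r \<circ> s" l] strict_mono_o[OF r s] by (simp add: o_assoc)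
    with s show ?thesis by blast
  qed
  show ?thesis
  proof (intro conjI allI impI; (elim conjE)?)
    show "\<exists>r. strict_mono (r :: nat \<Rightarrow> nat) \<and> convergent (a \<circ> r)"
      using subseq[of id] by (auto simp: convergent_def strict_mono_id)
    \<comment> \<open>A norm limit is also a weak limit, so \<open>weak_limit\<close> covers
      it.\<close>
    show "?mns l" if "strict_mono r" "(a \<circ> r) \<longlonglongrightarrow> l" for r :: "nat \<Rightarrow> nat" and l
      using weak_limit that tendsto_imp_weakly_converges by blast
    \<comment> \<open>Every subsequence has a further subsequence tending to a minimum-norm
      solution, which by uniqueness is always \<open>b\<close>.\<close>
    show "a \<longlonglongrightarrow> b" if "?mns b" and unique: "\<forall>b'. ?mns b' \<longrightarrow> b' = b" for b
      by (rule tendsto_of_subseq_tendsto) (use subseq unique in metis)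
  qed
qed

end
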